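(* Let $R$ be a commutative Krasner hyperring with nonzero identity, let $\phi$ be a hyperideal reduction and $\delta$ a hyperideal expansion, and let $\{M_i: i\in D\}$ be a directed set (under inclusion) of $\phi$-$\delta$-$r$-hyperideals of $R$. Then the hyperideal $M=\bigcup_{i\in D}M_i$ is a $\phi$-$\delta$-$r$-hyperideal of $R$.
   Context: A Krasner hyperring $(R,+,\cdot)$ is a set where $(R,+)$ is a canonical hypergroup (a commutative, associative hyperoperation with values nonempty subsets, an element $0$ with $x+0=\{x\}$, unique opposites $-x$ with $0\in x+(-x)$, and $z\in x+y$ implies $y\in -x+z$ and $x\in z-y$), $(R,\cdot)$ is a semigroup (single-valued multiplication) with $0$ bilaterally absorbing, and $\cdot$ is distributive over $+$. It is commutative with nonzero identity if $\cdot$ is commutative with an identity $1\neq 0$. A hyperideal is a nonempty $N\subseteq R$ with $x-y\subseteq N$ and $rx\in N$ for all $x,y\in N$, $r\in R$. For $a\in R$, $ann(a)=\{r\in R: ra=0\}$, and "$ann(a)=0$" means $ann(a)=\{0\}$. A hyperideal expansion is a function $\delta$ assigning to each hyperideal $N$ a hyperideal $\delta(N)$ of the same hyperring such that $N\subseteq\delta(N)$, and $N\subseteq M$ implies $\delta(N)\subseteq\delta(M)$. A hyperideal reduction is a function $\phi$ assigning to each hyperideal $N$ a hyperideal $\phi(N)$ of the same hyperring such that $\phi(N)\subseteq N$, and $N\subseteq M$ implies $\phi(N)\subseteq\phi(M)$. A proper hyperideal $N$ of $R$ is a $\phi$-$\delta$-$r$-hyperideal if for all $a,b\in R$, $a\cdot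 b\in N\setminus\phi(N)$ and $ann(a)=0$ imply $b\in\delta(N)$. *)

theory Defs
  imports "HOL-Algebra.Group"
begin

record 'a hyperring = "'a monoid" +
  hadd :: "'a \<Rightarrow> 'a \<Rightarrow> 'a set"  (infixl \<open>\<boxplus>\<index>\<close> 65)
  hzero :: 'a  (\<open>\<zero>\<index>\<close>)

definition hminus :: "('a, 'b) hyperring_scheme \<Rightarrow> 'a \<Rightarrow> 'a"  (\<open>\<boxminus>\<index> _\<close> [81] 80)
  where "\<boxminus>\<^bsub>R\<^esub> x = (THE y. y \<in> carrier R \<and> \<zero>\<^bsub>R\<^esub> \<in> x \<boxplus>\<^bsub>R\<^esub> y)"

locale canonical_hypergroup =
  fixes R (structure)
  assumes hadd_closed: "\<lbrakk>x \<in> carrier R; y \<in> carrier R\<rbrakk> \<Longrightarrow> x \<boxplus> y \<subseteq> carrier R"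
    and hadd_nonempty: "\<lbrakk>x \<in> carrier R; y \<in> carrier R\<rbrakk> \<Longrightarrow> x \<boxplus> y \<noteq> {}"
    and hadd_assoc: "\<lbrakk>x \<in> carrier R; y \<in> carrier R; z \<in> carrier R\<rbrakk>
      \<Longrightarrow> (\<Union>u\<in>x \<boxplus> y. u \<boxplus> z) = (\<Union>v\<in>y \<boxplus> z. x \<boxplus> v)"
    and hadd_comm: "\<lbrakk>x \<in> carrier R; y \<in> carrier R\<rbrakk> \<Longrightarrow> x \<boxplus> y = y \<boxplus> x"
    and hzero_closed: "\<zero> \<in> carrier R"
    and hadd_zero: "x \<in> carrier R \<Longrightarrow> x \<boxplus> \<zero> = {x}"
    and ex1_hminus: "x \<in> carrier R \<Longrightarrow> \<exists>!y. y \<in> carrier R \<and> \<zero> \<in> x \<boxplus> y"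
    and reversible_left: "\<lbrakk>x \<in> carrier R; y \<in> carrier R; z \<in> x \<boxplus> y\<rbrakk> \<Longrightarrow> y \<in> (\<boxminus> x) \<boxplus> z"
    and reversible_right: "\<lbrakk>x \<in> carrier R; y \<in> carrier R; z \<in> x \<boxplus> y\<rbrakk> \<Longrightarrow> x \<in> z \<boxplus> (\<boxminus> y)"

text \<open>The multiplication is only a semigroup here; the field \<open>\<one>\<close> of the record is unconstrained.\<close>

locale krasner_hyperring = canonical_hypergroup R for R (structure) +
  assumes mult_closed: "\<lbrakk>x \<in> carrier R; y \<in> carrier R\<rbrakk> \<Longrightarrow> x \<otimes> y \<in> carrier R"
    and mult_assoc: "\<lbrakk>x \<in> carrier R; y \<in> carrier R; z \<in> carrier R\<rbrakk>
      \<Longrightarrow> (x \<otimes> y) \<otimes> z = x \<otimes> (y \<otimes> z)"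
    and zero_mult: "x \<in> carrier R \<Longrightarrow> \<zero> \<otimes> x = \<zero>"
    and mult_zero: "x \<in> carrier R \<Longrightarrow> x \<otimes> \<zero> = \<zero>"
    and distrib_left: "\<lbrakk>x \<in> carrier R; y \<in> carrier R; z \<in> carrier R\<rbrakk>
      \<Longrightarrow> (\<lambda>u. x \<otimes> u) ` (y \<boxplus> z) = (x \<otimes> y) \<boxplus> (x \<otimes> z)"
    and distrib_right: "\<lbrakk>x \<in> carrier R; y \<in> carrier R; z \<in> carrier R\<rbrakk>
      \<Longrightarrow> (\<lambda>u. u \<otimes> x) ` (y \<boxplus> z) = (y \<otimes> x) \<boxplus> (z \<otimes> x)"

locale comm_krasner_hyperring_1 = krasner_hyperring R + comm_monoid R for R (structure) +
  assumes one_not_zero: "\<one> \<noteq> \<zero>"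

definition hyperideal :: "('a, 'b) hyperring_scheme \<Rightarrow> 'a set \<Rightarrow> bool"
  where "hyperideal R N \<longleftrightarrow> N \<subseteq> carrier R \<and> N \<noteq> {} \<and>
    (\<forall>x\<in>N. \<forall>y\<in>N. x \<boxplus>\<^bsub>R\<^esub> (\<boxminus>\<^bsub>R\<^esub> y) \<subseteq> N) \<and>
    (\<forall>r\<in>carrier R. \<forall>x\<in>N. r \<otimes>\<^bsub>R\<^esub> x \<in> N)"

definition ann :: "('a, 'b) hyperring_scheme \<Rightarrow> 'a \<Rightarrow> 'a set"
  where "ann R a = {r \<in> carrier R. r \<otimes>\<^bsub>R\<^esub> a = \<zero>\<^bsub>R\<^esub>}"

text \<open>Expansions and reductions are functions on hyperideals; their values on other sets
  are irrelevant.\<close>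

definition hyperideal_expansion :: "('a, 'b) hyperring_scheme \<Rightarrow> ('a set \<Rightarrow> 'a set) \<Rightarrow> bool"
  where "hyperideal_expansion R \<delta> \<longleftrightarrow>
    (\<forall>N. hyperideal R N \<longrightarrow> hyperideal R (\<delta> N) \<and> N \<subseteq> \<delta> N) \<and>
    (\<forall>N M. hyperideal R N \<longrightarrow> hyperideal R M \<longrightarrow> N \<subseteq> M \<longrightarrow> \<delta> N \<subseteq> \<delta> M)"

definition hyperideal_reduction :: "('a, 'b) hyperring_scheme \<Rightarrow> ('a set \<Rightarrow> 'a set) \<Rightarrow> bool"
  where "hyperideal_reduction R \<phi> \<longleftrightarrow>
    (\<forall>N. hyperideal R N \<longrightarrow> hyperideal R (\<phi> N) \<and> \<phi> N \<subseteq> N) \<and>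
    (\<forall>N M. hyperideal R N \<longrightarrow> hyperideal R M \<longrightarrow> N \<subseteq> M \<longrightarrow> \<phi> N \<subseteq> \<phi> M)"

definition phi_delta_r_hyperideal ::
    "('a, 'b) hyperring_scheme \<Rightarrow> ('a set \<Rightarrow> 'a set) \<Rightarrow> ('a set \<Rightarrow> 'a set) \<Rightarrow> 'a set \<Rightarrow> bool"
  where "phi_delta_r_hyperideal R \<phi> \<delta> N \<longleftrightarrow> hyperideal R N \<and> N \<noteq> carrier R \<and>
    (\<forall>a\<in>carrier R. \<forall>b\<in>carrier R.
      a \<otimes>\<^bsub>R\<^esub> b \<in> N - \<phi> N \<longrightarrow> ann R a = {\<zero>\<^bsub>R\<^esub>} \<longrightarrow> b \<in> \<delta> N)"

text \<open>As usual, directed sets are nonempty.\<close>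

definition directed_by_inclusion :: "'a set set \<Rightarrow> bool"
  where "directed_by_inclusion S \<longleftrightarrow> S \<noteq> {} \<and> (\<forall>A\<in>S. \<forall>B\<in>S. \<exists>C\<in>S. A \<subseteq> C \<and> B \<subseteq> C)"

end

theory Submission
  imports Defs
begin

text \<open>
  A pair of points of a directed union already lies in one member of the family, so the union of
  the \<open>M i\<close> is a hyperideal; it misses the identity because each \<open>M i\<close> does.
  For the \<open>\<phi>\<close>-\<open>\<delta>\<close> condition, a product in the union lies in some \<open>M i\<close>. Monotonicity of \<open>\<phi>\<close>
  makes \<open>\<phi> (M i)\<close> a part of \<open>\<phi>\<close> of the union, so a product that avoids the latter avoids the former
  and the hypothesis on \<open>M i\<close> applies; monotonicity of \<open>\<delta>\<close> then carries the conclusion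
  from \<open>\<delta> (M i)\<close> up to \<open>\<delta>\<close> of the union.
\<close>

lemma hyperideal_directed_Union:
  assumes dir: "directed_by_inclusion S"
    and ideal: "\<And>N. N \<in> S \<Longrightarrow> hyperideal R N"
  shows "hyperideal R (\<Union>S)"
  unfolding hyperideal_def
proof (intro conjI ballI)
  show "\<Union>S \<subseteq> carrier R"
    using ideal by (intro Union_least) (simp add: hyperideal_def)
  obtain N where "N \<in> S"
    using dir unfolding directed_by_inclusion_def by blast
  moreover from this have "N \<noteq> {}"
    using ideal by (simp add: hyperideal_def)
  ultimately show "\<Union>S \<noteq> {}" by blast
next
  fix x y assume "x \<in> \<Union>S" "y \<in> \<Union>S"
  then obtain N where N: "N \<in> S" "x \<in> N" "y \<in> N"
    using dir unfolding directed_by_inclusion_def by (meson UnionE subsetD)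
  then have "x \<boxplus>\<^bsub>R\<^esub> (\<boxminus>\<^bsub>R\<^esub> y) \<subseteq> N"
    using ideal by (simp add: hyperideal_def)
  then show "x \<boxplus>\<^bsub>R\<^esub> (\<boxminus>\<^bsub>R\<^esub> y) \<subseteq> \<Union>S"
    using N by blast
next
  fix r x assume r: "r \<in> carrier R" and "x \<in> \<Union>S"
  then obtain N where N: "N \<in> S" "x \<in> N" by blast
  then have "r \<otimes>\<^bsub>R\<^esub> x \<in> N"
    using ideal r by (simp add: hyperideal_def)
  then show "r \<otimes>\<^bsub>R\<^esub> x \<in> \<Union>S"
    using N by blast
qed

lemma (in comm_krasner_hyperring_1) hyperideal_eq_carrier_iff:
  assumes "hyperideal R N"
  shows "N = carrier R \<longleftrightarrow> \<one> \<in> N"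
proof
  assume "\<one> \<in> N"
  then have "r \<in> N" if "r \<in> carrier R" for r
    using assms that r_one[OF that] unfolding hyperideal_def by metis
  then show "N = carrier R"
    using assms unfolding hyperideal_def by blast
qed simp

theorem proposition3p4:
  fixes R :: "('a, 'b) hyperring_scheme"
    and \<phi> \<delta> :: "'a set \<Rightarrow> 'a set"
    and D :: "'i set"
    and M :: "'i \<Rightarrow> 'a set"
  assumes "comm_krasner_hyperring_1 R"
    and "hyperideal_reduction R \<phi>"
    and "hyperideal_expansion R \<delta>"
    and "directed_by_inclusion (M ` D)"
    and "\<forall>i\<in>D. phi_delta_r_hyperideal R \<phi> \<delta> (M i)"
  shows "phi_delta_r_hyperideal R \<phi> \<delta> (\<Union>i\<in>D. M i)"
proof -
  interpret comm_krasner_hyperring_1 R by fact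
  let ?U = "\<Union>i\<in>D. M i"
  have ideal: "hyperideal R (M i)" if "i \<in> D" for i
    using assms(5) that by (simp add: phi_delta_r_hyperideal_def)
  have U: "hyperideal R ?U"
    by (rule hyperideal_directed_Union[OF assms(4)]) (use ideal in auto)
  have "\<one>\<^bsub>R\<^esub> \<notin> M i" if "i \<in> D" for i
    using assms(5) that hyperideal_eq_carrier_iff[OF ideal[OF that]]
    by (simp add: phi_delta_r_hyperideal_def)
  then have proper: "?U \<noteq> carrier R"
    using hyperideal_eq_carrier_iff[OF U] by blast
  have "b \<in> \<delta> ?U"
    if ab: "a \<in> carrier R" "b \<in> carrier R" "a \<otimes>\<^bsub>R\<^esub> b \<in> ?U - \<phi> ?U"
      and ann: "ann R a = {\<zero>\<^bsub>R\<^esub>}" for a b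
  proof -
    obtain i where i: "i \<in> D" "a \<otimes>\<^bsub>R\<^esub> b \<in> M i"
      using ab by blast
    then have sub: "M i \<subseteq> ?U" by blast
    have "\<phi> (M i) \<subseteq> \<phi> ?U"
      using assms(2) ideal[OF i(1)] U sub unfolding hyperideal_reduction_def by blast
    then have "a \<otimes>\<^bsub>R\<^esub> b \<in> M i - \<phi> (M i)"
      using ab i by blast
    then have "b \<in> \<delta> (M i)"
      using assms(5) i(1) ab(1,2) ann unfolding phi_delta_r_hyperideal_def by blast
    moreover have "\<delta> (M i) \<subseteq> \<delta> ?U"
      using assms(3) ideal[OF i(1)] U sub unfolding hyperideal_expansion_def by blast
    ultimately show ?thesis by blast
  qed
  then show ?thesis
    using U proper unfolding phi_delta_r_hyperideal_def by blast
qed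

end
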